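(* Let $\tau_p\in\{K_{tot},\dots,T\}$ be fixed, let $\nu_i=K_{tot}-K_i$ with $N>\nu_i$ for all $i\in\mathcal{G}$, and consider the max-min fairness problem $$\max_{\{p_{jk}^u\},\{p_{jk}^{dl}\}}\ \min_{j\in\mathcal{G}}\ \min_{k\in\mathcal{K}_j}\ \mathrm{SINR}_{jk}\quad\text{s.t.}\quad p_{jk}^u\le p_{jk}^{utot}\quad(\forall j\in\mathcal{G},\ k\in\mathcal{K}_j),\qquad P=P_{tot},$$ where $P=\sum_{j=1}^{G}\sum_{k=1}^{K_j}p_{jk}^{dl}$ is the total downlink power used at the base station, $P_{tot}$ is the total power available at the base station, $p_{jk}^{utot}$ are given maximum pilot powers, and $$\mathrm{SINR}_{ik}=\frac{(N-\nu_i)\,\gamma_{ik}\,p_{ik}^{dl}}{1+\gamma_{ik}\sum_{m=1}^{K_i}p_{im}^{dl}+(\beta_{ik}-\gamma_{ik})P},\qquad \gamma_{ik}=\frac{\tau_p p_{ik}^u\beta_{ik}^2}{1+\tau_p p_{ik}^u\beta_{ik}}.$$ Then at the optimal solution all users in the system receive the same effective SINR, i.e. $\Gamma=\mathrm{SINR}_{ik}$ for all $i\in\mathcal{G}$, $k\in\mathcal{K}_i$, and $\Gamma$ is the solution of the equation $$P=\sum_{i=1}^{G}\frac{\Gamma\,\Delta_i}{N-\nu_i-\Gamma K_i},$$ where $$\Delta_i=\sum_{k=1}^{K_i}\Bigl(\frac{1}{\gamma_{ik}^*}+P\frac{\beta_{ik}}{\gamma_{ik}^*}-P\Bigr),\qquad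 \gamma_{ik}^*=\frac{\tau_p p_{ik}^{utot}\beta_{ik}^2}{1+\tau_p p_{ik}^{utot}\beta_{ik}}.$$ The optimal uplink training and downlink transmission powers of user $k$ in group $i$ are $$p_{ik}^{u*}=p_{ik}^{utot},\qquad p_{ik}^{dl*}=\frac{\Gamma}{N-\nu_i}\Bigl(\frac{1}{\gamma_{ik}^*}+P_i^{dl}+P\frac{\beta_{ik}}{\gamma_{ik}^*}-P\Bigr),\qquad\text{where } P_i^{dl}=\frac{\Gamma\Delta_i}{N-\nu_i-\Gamma K_i}.$$
   Context: $G$ is the number of multicast groups, $\mathcal{G}=\{1,\dots,G\}$; group $j$ has $K_j$ users indexed by $\mathcal{K}_j=\{1,\dots,K_j\}$, each user belongs to exactly one group, and $K_{tot}=\sum_{j=1}^{G}K_j$. $N$ is the number of base station antennas, $T$ is the coherence interval length in symbols, $\tau_p$ is the pilot length, and $\beta_{jk}>0$ is the given large-scale fading coefficient of user $k$ in group $j$. The optimization variables $p_{jk}^u$ and $p_{jk}^{dl}$ are the uplink pilot power and the downlink power of that user; being powers, they are nonnegative, and the limits $p_{jk}^{utot}$ and $P_{tot}$ are positive. $\mathrm{SINR}_{ik}$ is the effective SINR of user $k$ in group $i$ when the two-layered multicast precoder (an outer layer that cancels inter-group interference by zero-forcing on the estimated channels, and an inner layer that is a weighted sum of the channel estimates of the group's users) is used; for the claim only its displayed formula is needed. *)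

theory Defs
  imports Complex_Main
begin

text \<open>
  Groups are indexed by \<open>{1..G}\<close>, the users of group \<open>j\<close> by \<open>{1..K j}\<close>. Per-user quantities are
  functions \<open>nat \<Rightarrow> nat \<Rightarrow> real\<close> (group, user); only their values at these indices matter.
\<close>

definition K_tot :: "nat \<Rightarrow> (nat \<Rightarrow> nat) \<Rightarrow> nat" where
  "K_tot G K = (\<Sum>j=1..G. K j)"

text \<open>The natural-number subtraction is exact, since \<open>K i \<le> K_tot G K\<close> for every group \<open>i\<close>.\<close>

definition nu :: "nat \<Rightarrow> (nat \<Rightarrow> nat) \<Rightarrow> nat \<Rightarrow> nat" where
  "nu G K i = K_tot G K - K i"

definition gamma :: "nat \<Rightarrow> (nat \<Rightarrow> nat \<Rightarrow> real) \<Rightarrow> (nat \<Rightarrow> nat \<Rightarrow> real) \<Rightarrow> nat \<Rightarrow> nat \<Rightarrow> real" where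
  "gamma \<tau> \<beta> pu i k = (real \<tau> * pu i k * (\<beta> i k)\<^sup>2) / (1 + real \<tau> * pu i k * \<beta> i k)"

definition total_power :: "nat \<Rightarrow> (nat \<Rightarrow> nat) \<Rightarrow> (nat \<Rightarrow> nat \<Rightarrow> real) \<Rightarrow> real" where
  "total_power G K pdl = (\<Sum>j=1..G. \<Sum>k=1..K j. pdl j k)"

definition SINR ::
  "nat \<Rightarrow> (nat \<Rightarrow> nat) \<Rightarrow> nat \<Rightarrow> nat \<Rightarrow> (nat \<Rightarrow> nat \<Rightarrow> real) \<Rightarrow>
   (nat \<Rightarrow> nat \<Rightarrow> real) \<Rightarrow> (nat \<Rightarrow> nat \<Rightarrow> real) \<Rightarrow> nat \<Rightarrow> nat \<Rightarrow> real" where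
  "SINR G K N \<tau> \<beta> pu pdl i k =
     ((real N - real (nu G K i)) * gamma \<tau> \<beta> pu i k * pdl i k) /
     (1 + gamma \<tau> \<beta> pu i k * (\<Sum>m=1..K i. pdl i m)
        + (\<beta> i k - gamma \<tau> \<beta> pu i k) * total_power G K pdl)"

definition min_SINR ::
  "nat \<Rightarrow> (nat \<Rightarrow> nat) \<Rightarrow> nat \<Rightarrow> nat \<Rightarrow> (nat \<Rightarrow> nat \<Rightarrow> real) \<Rightarrow>
   (nat \<Rightarrow> nat \<Rightarrow> real) \<Rightarrow> (nat \<Rightarrow> nat \<Rightarrow> real) \<Rightarrow> real" where
  "min_SINR G K N \<tau> \<beta> pu pdl = (MIN j\<in>{1..G}. MIN k\<in>{1..K j}. SINR G K N \<tau> \<beta> pu pdl j k)"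

definition feasible ::
  "nat \<Rightarrow> (nat \<Rightarrow> nat) \<Rightarrow> (nat \<Rightarrow> nat \<Rightarrow> real) \<Rightarrow> real \<Rightarrow>
   (nat \<Rightarrow> nat \<Rightarrow> real) \<Rightarrow> (nat \<Rightarrow> nat \<Rightarrow> real) \<Rightarrow> bool" where
  "feasible G K putot Ptot pu pdl \<longleftrightarrow>
     (\<forall>j\<in>{1..G}. \<forall>k\<in>{1..K j}. 0 \<le> pu j k \<and> pu j k \<le> putot j k \<and> 0 \<le> pdl j k) \<and>
     total_power G K pdl = Ptot"

definition max_min_optimal ::
  "nat \<Rightarrow> (nat \<Rightarrow> nat) \<Rightarrow> nat \<Rightarrow> nat \<Rightarrow> (nat \<Rightarrow> nat \<Rightarrow> real) \<Rightarrow> (nat \<Rightarrow> nat \<Rightarrow> real) \<Rightarrow> real \<Rightarrow>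
   (nat \<Rightarrow> nat \<Rightarrow> real) \<Rightarrow> (nat \<Rightarrow> nat \<Rightarrow> real) \<Rightarrow> bool" where
  "max_min_optimal G K N \<tau> \<beta> putot Ptot pu pdl \<longleftrightarrow>
     is_arg_max (\<lambda>(qu, qdl). min_SINR G K N \<tau> \<beta> qu qdl)
                (\<lambda>(qu, qdl). feasible G K putot Ptot qu qdl) (pu, pdl)"

text \<open>
  Below, \<open>P\<close> is the value of the total downlink power, and \<open>gamma \<tau> \<beta> putot\<close> is the
  quantity \<open>\<gamma>\<^sup>*\<close>, that is, \<open>gamma\<close> at full pilot power.
\<close>

definition Delta ::
  "(nat \<Rightarrow> nat) \<Rightarrow> nat \<Rightarrow> (nat \<Rightarrow> nat \<Rightarrow> real) \<Rightarrow> (nat \<Rightarrow> nat \<Rightarrow> real) \<Rightarrow> real \<Rightarrow> nat \<Rightarrow> real" where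
  "Delta K \<tau> \<beta> putot P i =
     (\<Sum>k=1..K i. 1 / gamma \<tau> \<beta> putot i k + P * (\<beta> i k / gamma \<tau> \<beta> putot i k) - P)"

definition group_power ::
  "nat \<Rightarrow> (nat \<Rightarrow> nat) \<Rightarrow> nat \<Rightarrow> nat \<Rightarrow> (nat \<Rightarrow> nat \<Rightarrow> real) \<Rightarrow> (nat \<Rightarrow> nat \<Rightarrow> real) \<Rightarrow>
   real \<Rightarrow> real \<Rightarrow> nat \<Rightarrow> real" where
  "group_power G K N \<tau> \<beta> putot P \<Gamma> i =
     (\<Gamma> * Delta K \<tau> \<beta> putot P i) / (real N - real (nu G K i) - \<Gamma> * real (K i))"

definition optimal_pdl ::
  "nat \<Rightarrow> (nat \<Rightarrow> nat) \<Rightarrow> nat \<Rightarrow> nat \<Rightarrow> (nat \<Rightarrow> nat \<Rightarrow> real) \<Rightarrow> (nat \<Rightarrow> nat \<Rightarrow> real) \<Rightarrow>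
   real \<Rightarrow> real \<Rightarrow> nat \<Rightarrow> nat \<Rightarrow> real" where
  "optimal_pdl G K N \<tau> \<beta> putot P \<Gamma> i k =
     \<Gamma> / (real N - real (nu G K i)) *
       (1 / gamma \<tau> \<beta> putot i k + group_power G K N \<tau> \<beta> putot P \<Gamma> i
          + P * (\<beta> i k / gamma \<tau> \<beta> putot i k) - P)"

end

theory Submission
  imports Defs
begin

text \<open>
  Where \<open>\<gamma>\<^sub>i\<^sub>k > 0\<close>, dividing numerator and denominator by \<open>\<gamma>\<^sub>i\<^sub>k\<close> gives
  \<open>SINR\<^sub>i\<^sub>k = (N - \<nu>\<^sub>i) p\<^sub>i\<^sub>k / (a\<^sub>i\<^sub>k + S\<^sub>i)\<close>, where \<open>S\<^sub>i\<close> is the power of group \<open>i\<close> and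
  \<open>a\<^sub>i\<^sub>k = (1 + P \<beta>\<^sub>i\<^sub>k) / \<gamma>\<^sub>i\<^sub>k - P\<close> is strictly decreasing in the pilot power. If every SINR is
  at least \<open>\<Gamma>\<close>, then summing \<open>(N - \<nu>\<^sub>i) p\<^sub>i\<^sub>k \<ge> \<Gamma> (a\<^sub>i\<^sub>k + S\<^sub>i) \<ge> \<Gamma> (a\<^sup>*\<^sub>i\<^sub>k + S\<^sub>i)\<close> over \<open>k\<close> yields
  \<open>S\<^sub>i \<ge> \<Gamma> \<Delta>\<^sub>i / (N - \<nu>\<^sub>i - \<Gamma> K\<^sub>i)\<close>. The sum of these bounds over \<open>i\<close> increases strictly in \<open>\<Gamma>\<close>,
  so it equals \<open>P\<close> for exactly one \<open>\<Gamma>\<close>. For that \<open>\<Gamma>\<close> all the inequalities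
  are tight, which forces full pilot power and the stated downlink powers.
\<close>

section \<open>Monotonicity and unique solvability of the power balance equation\<close>

lemma sum_le_imp_eq:
  fixes f g :: "'a \<Rightarrow> real"
  assumes "finite A" "\<And>x. x \<in> A \<Longrightarrow> f x \<le> g x" "sum g A \<le> sum f A" "x \<in> A"
  shows "f x = g x"
  using sum_strict_mono_ex1[of A f g] assms by (meson not_le order_antisym)

text \<open>After cross-multiplication both sides contain the same term in \<open>x * y\<close>,
  leaving \<open>x * D * M < y * D * M\<close>. The sign of \<open>x\<close> is left open so that
  uniqueness below ranges over all reals.\<close>

lemma ratio_strict_mono:
  fixes x y D M k :: real
  assumes "x < y" "0 < D" "0 < M" "0 < k" "0 < M - y * k"
  shows "x * D / (M - x * k) < y * D / (M - y * k)"
proof -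
  have "x * k < y * k" using assms by simp
  then have pos: "0 < M - x * k" using assms by linarith
  have "x * (D * M) < y * (D * M)" using assms by simp
  then have "x * D * (M - y * k) < y * D * (M - x * k)" by (simp add: algebra_simps)
  then show ?thesis using pos assms by (simp add: divide_simps mult.commute)
qed

text \<open>The intermediate value theorem gives a root left of every pole, and strict monotonicity
  there makes it the only one. Positive denominators single out this branch, since other roots may
  lie between poles.\<close>

lemma ex1_sum_ratio_eq:
  fixes M k D :: "'a \<Rightarrow> real" and P :: real
  assumes fin: "finite I" and ne: "I \<noteq> {}"
    and pos: "\<And>i. i \<in> I \<Longrightarrow> 0 < M i" "\<And>i. i \<in> I \<Longrightarrow> 0 < k i" "\<And>i. i \<in> I \<Longrightarrow> 0 < D i"
    and P: "0 < P"
  shows "\<exists>x>0. \<forall>y. ((\<forall>i\<in>I. 0 < M i - y * k i) \<and> P = (\<Sum>i\<in>I. y * D i / (M i - y * k i)))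
                    \<longleftrightarrow> y = x"
proof -
  define F where "F y = (\<Sum>i\<in>I. y * D i / (M i - y * k i))" for y
  have F_less: "F x < F y" if "x < y" "\<forall>i\<in>I. 0 < M i - y * k i" for x y
    unfolding F_def using that fin ne pos by (intro sum_strict_mono ratio_strict_mono) auto
  define m where "m = Min ((\<lambda>i. M i / k i) ` I)"
  have "m \<in> (\<lambda>i. M i / k i) ` I" unfolding m_def using fin ne by (intro Min_in) auto
  \<comment> \<open>\<open>j\<close> belongs to the smallest pole, so staying below
    \<open>M j / k j\<close> keeps every denominator positive.\<close>
  then obtain j where j: "j \<in> I" "m = M j / k j" by auto
  have m_le: "m \<le> M i / k i" if "i \<in> I" for i unfolding m_def using fin that by auto
  have den: "0 < M i - y * k i" if "y < m" "i \<in> I" for y i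
  proof -
    have "y < M i / k i" using m_le that by force
    then show ?thesis using pos that by (simp add: pos_less_divide_eq)
  qed
  \<comment> \<open>At \<open>b\<close> the \<open>j\<close>-th summand alone already equals \<open>P\<close>.\<close>
  define b where "b = P * M j / (D j + P * k j)"
  note pj = pos[OF j(1)]
  have sj: "0 < D j + P * k j" using pj P by (simp add: add_pos_pos)
  have b0: "0 < b" unfolding b_def using pj P sj by simp
  have bm: "b < m" unfolding b_def j(2) using pj P sj by (simp add: divide_simps algebra_simps)
  have Mb: "M j - b * k j = M j * D j / (D j + P * k j)"
    unfolding b_def using sj by (simp add: field_simps)
  have "b * D j / (M j - b * k j) = P"
    unfolding Mb unfolding b_def using pj sj by simp
  moreover have "b * D j / (M j - b * k j) \<le> F b"
    unfolding F_def
    by (rule member_le_sum[where f = "\<lambda>i. b * D i / (M i - b * k i)"])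
      (use j fin b0 pos den bm in \<open>auto intro!: divide_nonneg_pos mult_nonneg_nonneg simp: less_imp_le\<close>)
  ultimately have "P \<le> F b" by simp
  moreover have "F 0 \<le> P" unfolding F_def using P by simp
  moreover have "continuous_on {0..b} F"
    unfolding F_def
  proof (intro continuous_intros ballI)
    fix i x assume "i \<in> I" "x \<in> {0..b}"
    then have "0 < M i - x * k i" using bm by (intro den) auto
    then show "M i - x * k i \<noteq> 0" by simp
  qed
  ultimately obtain x where x: "0 \<le> x" "x \<le> b" "F x = P"
    using IVT'[of F 0 P b] b0 by auto
  have x0: "0 < x"
    using x P unfolding F_def by (cases "x = 0") auto
  have xd: "\<forall>i\<in>I. 0 < M i - x * k i" using x bm den by auto
  have "y = x" if "\<forall>i\<in>I. 0 < M i - y * k i" "P = F y" for y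
    using F_less[of x y] F_less[of y x] x xd that by (cases x y rule: linorder_cases) auto
  then show ?thesis using x0 xd x unfolding F_def by blast
qed

section \<open>The channel estimate quality as a function of pilot power\<close>

lemma gamma_strict_mono:
  assumes "0 < \<tau>" "0 < \<beta> i k" "0 \<le> p i k" "p i k < q i k"
  shows "gamma \<tau> \<beta> p i k < gamma \<tau> \<beta> q i k"
proof -
  let ?t = "real \<tau> * \<beta> i k"
  have t: "0 < ?t" using assms by simp
  have pq: "?t * p i k < ?t * q i k" "0 \<le> ?t * p i k"
    using assms t by auto
  have g: "gamma \<tau> \<beta> r i k = \<beta> i k * (1 - 1 / (1 + ?t * r i k))" if "0 \<le> ?t * r i k" for r
    unfolding gamma_def using that by (simp add: field_simps power2_eq_square)
  have "1 / (1 + ?t * q i k) < 1 / (1 + ?t * p i k)"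
    using pq by (intro divide_strict_left_mono) auto
  then show ?thesis using g[of p] g[of q] pq assms by simp
qed

lemma gamma_pos:
  assumes "0 < \<tau>" "0 < \<beta> i k" "0 < p i k"
  shows "0 < gamma \<tau> \<beta> p i k"
  unfolding gamma_def using assms by (intro divide_pos_pos mult_pos_pos add_pos_pos) auto

lemma gamma_less:
  assumes "0 < \<tau>" "0 < \<beta> i k" "0 \<le> p i k"
  shows "gamma \<tau> \<beta> p i k < \<beta> i k"
proof -
  have "0 \<le> real \<tau> * p i k * \<beta> i k" using assms by simp
  then have d: "0 < 1 + real \<tau> * p i k * \<beta> i k" by linarith
  have "real \<tau> * p i k * (\<beta> i k)\<^sup>2 < \<beta> i k * (1 + real \<tau> * p i k * \<beta> i k)"
    using assms by (simp add: algebra_simps power2_eq_square)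
  then show ?thesis unfolding gamma_def using d by (simp add: pos_divide_less_eq)
qed

section \<open>The SINR rescaled by \<open>gamma\<close>, and the powers of a group\<close>

locale multicast =
  fixes G N \<tau> :: nat and K :: "nat \<Rightarrow> nat"
    and \<beta> putot :: "nat \<Rightarrow> nat \<Rightarrow> real" and Ptot :: real
  assumes G: "1 \<le> G"
    and K: "\<And>j. j \<in> {1..G} \<Longrightarrow> 1 \<le> K j"
    and \<tau>: "0 < \<tau>"
    and N: "\<And>i. i \<in> {1..G} \<Longrightarrow> nu G K i < N"
    and \<beta>: "\<And>j k. j \<in> {1..G} \<Longrightarrow> k \<in> {1..K j} \<Longrightarrow> 0 < \<beta> j k"
    and putot: "\<And>j k. j \<in> {1..G} \<Longrightarrow> k \<in> {1..K j} \<Longrightarrow> 0 < putot j k"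
    and Ptot: "0 < Ptot"
begin

text \<open>The coefficient \<open>a\<close> of the overview: with the total power fixed at
  \<open>Ptot\<close>, it depends on the pilot powers alone.\<close>

definition noise :: "(nat \<Rightarrow> nat \<Rightarrow> real) \<Rightarrow> nat \<Rightarrow> nat \<Rightarrow> real" where
  "noise pu i k = 1 / gamma \<tau> \<beta> pu i k + Ptot * (\<beta> i k / gamma \<tau> \<beta> pu i k) - Ptot"

definition M :: "nat \<Rightarrow> real" where
  "M i = real N - real (nu G K i)"

abbreviation "\<gamma> \<equiv> gamma \<tau> \<beta>"
abbreviation "sinr \<equiv> SINR G K N \<tau> \<beta>"
abbreviation "\<Delta> \<equiv> Delta K \<tau> \<beta> putot Ptot"

lemma M_pos: "i \<in> {1..G} \<Longrightarrow> 0 < M i"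
  using N by (simp add: M_def)

lemma Delta_noise: "\<Delta> i = (\<Sum>k=1..K i. noise putot i k)"
  by (simp add: Delta_def noise_def)

context
  fixes i k
  assumes ik: "i \<in> {1..G}" "k \<in> {1..K i}"
begin

lemma noise_eq:
  assumes "0 < pu i k"
  shows "noise pu i k = (1 + (\<beta> i k - \<gamma> pu i k) * Ptot) / \<gamma> pu i k"
  using gamma_pos[of \<tau> \<beta> i k pu] \<tau> \<beta>[OF ik] assms by (simp add: noise_def field_simps)

lemma noise_pos:
  assumes "0 < pu i k"
  shows "0 < noise pu i k"
proof -
  have "0 \<le> (\<beta> i k - \<gamma> pu i k) * Ptot"
    using gamma_less[of \<tau> \<beta> i k pu] \<tau> \<beta>[OF ik] assms Ptot by simp
  then show ?thesis
    using noise_eq[of pu, OF assms] gamma_pos[of \<tau> \<beta> i k pu] \<tau> \<beta>[OF ik] assms by simp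
qed

text \<open>Up to the constant \<open>Ptot\<close>, \<open>noise\<close> is a positive number
  divided by the increasing \<open>gamma\<close>. At pilot power 0 this breaks down: division by
  zero would make \<open>noise\<close> equal to \<open>- Ptot\<close>.\<close>

lemma noise_strict_antimono:
  assumes "0 < pu i k" "pu i k < pu' i k"
  shows "noise pu' i k < noise pu i k"
proof -
  have g: "0 < \<gamma> pu i k" using gamma_pos \<tau> \<beta>[OF ik] assms by simp
  moreover have "\<gamma> pu i k < \<gamma> pu' i k"
    using gamma_strict_mono \<tau> \<beta>[OF ik] assms by simp
  moreover have "0 < 1 + Ptot * \<beta> i k" using Ptot \<beta>[OF ik] by (simp add: add_pos_pos)
  ultimately have "(1 + Ptot * \<beta> i k) / \<gamma> pu' i k < (1 + Ptot * \<beta> i k) / \<gamma> pu i k"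
    by (intro divide_strict_left_mono) auto
  then show ?thesis by (simp add: noise_def add_divide_distrib)
qed

lemma SINR_eq:
  assumes "0 < pu i k" "total_power G K pdl = Ptot"
  shows "sinr pu pdl i k = M i * pdl i k / (noise pu i k + (\<Sum>m=1..K i. pdl i m))"
proof -
  have g: "0 < \<gamma> pu i k" using gamma_pos \<tau> \<beta>[OF ik] assms by simp
  have "\<gamma> pu i k * noise pu i k = 1 + (\<beta> i k - \<gamma> pu i k) * Ptot"
    using g by (subst noise_eq) (use assms in auto)
  then have "1 + \<gamma> pu i k * (\<Sum>m=1..K i. pdl i m) + (\<beta> i k - \<gamma> pu i k) * Ptot
      = \<gamma> pu i k * (noise pu i k + (\<Sum>m=1..K i. pdl i m))"
    by (simp add: distrib_left)
  then show ?thesis unfolding SINR_def M_def assms(2) using g by simp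
qed

end

lemma Delta_pos: "i \<in> {1..G} \<Longrightarrow> 0 < \<Delta> i"
  unfolding Delta_noise using K[of i] noise_pos putot by (intro sum_pos) auto

lemma optimal_pdl_eq:
  "optimal_pdl G K N \<tau> \<beta> putot Ptot \<Gamma> i k
     = \<Gamma> / M i * (noise putot i k + group_power G K N \<tau> \<beta> putot Ptot \<Gamma> i)"
  by (simp add: optimal_pdl_def noise_def M_def algebra_simps)

text \<open>Summing the optimal powers of a group gives a linear equation for the group's own power;
  \<open>group_power\<close> is its solution.\<close>

lemma group_power_fixpoint:
  assumes "i \<in> {1..G}" "0 < M i - \<Gamma> * real (K i)"
  shows "\<Gamma> / M i * (\<Delta> i + real (K i) * group_power G K N \<tau> \<beta> putot Ptot \<Gamma> i)
         = group_power G K N \<tau> \<beta> putot Ptot \<Gamma> i"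
proof -
  have gp: "group_power G K N \<tau> \<beta> putot Ptot \<Gamma> i = \<Gamma> * \<Delta> i / (M i - \<Gamma> * real (K i))"
    by (simp add: group_power_def M_def)
  show ?thesis unfolding gp using assms M_pos[of i] by (simp add: field_simps)
qed

lemma min_SINR_le:
  assumes "i \<in> {1..G}" "k \<in> {1..K i}"
  shows "min_SINR G K N \<tau> \<beta> pu pdl \<le> sinr pu pdl i k"
proof -
  have "min_SINR G K N \<tau> \<beta> pu pdl \<le> (MIN k\<in>{1..K i}. sinr pu pdl i k)"
    unfolding min_SINR_def using assms by (intro Min_le) auto
  also have "\<dots> \<le> sinr pu pdl i k" using assms by (intro Min_le) auto
  finally show ?thesis .
qed

lemma min_SINR_const:
  assumes "\<And>i k. i \<in> {1..G} \<Longrightarrow> k \<in> {1..K i} \<Longrightarrow> sinr pu pdl i k = \<Gamma>"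
  shows "min_SINR G K N \<tau> \<beta> pu pdl = \<Gamma>"
proof -
  have "(MIN k\<in>{1..K i}. sinr pu pdl i k) = \<Gamma>" if "i \<in> {1..G}" for i
  proof -
    have "sinr pu pdl i ` {1..K i} = {\<Gamma>}"
      using assms[OF that] K[OF that] by (auto intro!: image_eqI[of _ _ 1])
    then show ?thesis by simp
  qed
  then have "(\<lambda>i. MIN k\<in>{1..K i}. sinr pu pdl i k) ` {1..G} = {\<Gamma>}"
    using G by (auto intro!: image_eqI[of _ _ 1])
  then show ?thesis by (simp add: min_SINR_def)
qed

text \<open>A predicate on the valid indices rather than an equation of functions, because
  optimality does not see values elsewhere.\<close>

definition candidate :: "real \<Rightarrow> (nat \<Rightarrow> nat \<Rightarrow> real) \<Rightarrow> (nat \<Rightarrow> nat \<Rightarrow> real) \<Rightarrow> bool" where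
  "candidate \<Gamma> pu pdl \<longleftrightarrow> (\<forall>i\<in>{1..G}. \<forall>k\<in>{1..K i}.
     pu i k = putot i k \<and> pdl i k = optimal_pdl G K N \<tau> \<beta> putot Ptot \<Gamma> i k)"

section \<open>Optimality for a fixed positive root \<Gamma> of the balance equation\<close>

context
  fixes \<Gamma> :: real
  assumes \<Gamma>_pos: "0 < \<Gamma>"
    and den: "\<forall>i\<in>{1..G}. 0 < M i - \<Gamma> * real (K i)"
    and balance: "Ptot = (\<Sum>i=1..G. \<Gamma> * \<Delta> i / (M i - \<Gamma> * real (K i)))"
begin

abbreviation "S \<equiv> group_power G K N \<tau> \<beta> putot Ptot \<Gamma>"

lemma S_eq: "S i = \<Gamma> * \<Delta> i / (M i - \<Gamma> * real (K i))"
  by (simp add: group_power_def M_def)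

text \<open>The fixpoint equation makes each group sum equal to \<open>S i\<close>, and
  \<open>balance\<close> then gives the total \<open>Ptot\<close>. Each power is \<Gamma> /
  \<open>M i\<close> times the denominator of its rescaled SINR.\<close>

lemma candidate_SINR:
  assumes "candidate \<Gamma> pu pdl"
  shows "feasible G K putot Ptot pu pdl"
    and "i \<in> {1..G} \<Longrightarrow> k \<in> {1..K i} \<Longrightarrow> sinr pu pdl i k = \<Gamma>"
proof -
  have pu: "pu i k = putot i k" and pdl: "pdl i k = \<Gamma> / M i * (noise putot i k + S i)"
    if "i \<in> {1..G}" "k \<in> {1..K i}" for i k
    using assms that by (auto simp: candidate_def optimal_pdl_eq)
  have S0: "0 < S i" if "i \<in> {1..G}" for i
    unfolding S_eq using \<Gamma>_pos den Delta_pos that by simp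
  have sum: "(\<Sum>m=1..K i. pdl i m) = S i" if i: "i \<in> {1..G}" for i
  proof -
    have "(\<Sum>m=1..K i. pdl i m) = (\<Sum>m=1..K i. \<Gamma> / M i * (noise putot i m + S i))"
      using pdl[OF i] by (intro sum.cong) auto
    also have "\<dots> = \<Gamma> / M i * (\<Delta> i + real (K i) * S i)"
      unfolding sum_distrib_left[symmetric] by (simp add: sum.distrib Delta_noise)
    finally show ?thesis using group_power_fixpoint[OF i bspec[OF den i]] by simp
  qed
  have tot: "total_power G K pdl = Ptot"
    unfolding total_power_def using sum balance by (simp add: S_eq)
  have "0 \<le> pdl i k" if "i \<in> {1..G}" "k \<in> {1..K i}" for i k
    unfolding pdl[OF that]
    using \<Gamma>_pos M_pos[of i] noise_pos[OF that, of putot] putot[OF that] S0[of i] that by simp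
  then show "feasible G K putot Ptot pu pdl"
    unfolding feasible_def using tot pu putot by (auto simp: less_imp_le)
  show "sinr pu pdl i k = \<Gamma>" if ik: "i \<in> {1..G}" "k \<in> {1..K i}"
  proof -
    have "noise pu i k = noise putot i k" by (simp add: noise_def gamma_def pu[OF ik])
    moreover have "0 < noise putot i k + S i"
      using noise_pos[OF ik, of putot] putot[OF ik] S0[of i] ik by simp
    ultimately show ?thesis
      using SINR_eq[OF ik, of pu pdl] tot pu[OF ik] putot[OF ik] sum[of i] pdl[OF ik] M_pos[of i] ik
      by simp
  qed
qed

text \<open>Tightness passes from the total to the groups, then to the users, and finally to the
  pilot powers.\<close>

lemma SINR_ge_imp_candidate:
  assumes feas: "feasible G K putot Ptot pu pdl"
    and ge: "\<And>i k. i \<in> {1..G} \<Longrightarrow> k \<in> {1..K i} \<Longrightarrow> \<Gamma> \<le> sinr pu pdl i k"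
  shows "candidate \<Gamma> pu pdl"
proof -
  define R where "R i = (\<Sum>m=1..K i. pdl i m)" for i
  have tot: "total_power G K pdl = Ptot" using feas by (simp add: feasible_def)
  have fe: "0 \<le> pu i k" "pu i k \<le> putot i k" "0 \<le> pdl i k"
    if "i \<in> {1..G}" "k \<in> {1..K i}" for i k
    using feas that by (auto simp: feasible_def)
  have pu0: "0 < pu i k" if "i \<in> {1..G}" "k \<in> {1..K i}" for i k
  proof (rule ccontr)
    assume "\<not> 0 < pu i k"
    \<comment> \<open>A zero pilot makes \<open>gamma\<close> vanish, and with it the
      numerator.\<close>
    then have "sinr pu pdl i k = 0" using fe[OF that] by (simp add: SINR_def gamma_def)
    then show False using ge[OF that] \<Gamma>_pos by simp
  qed
  have R0: "0 \<le> R i" if "i \<in> {1..G}" for i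
    unfolding R_def using fe[OF that] by (intro sum_nonneg) auto
  have noise_le: "noise putot i k \<le> noise pu i k" if "i \<in> {1..G}" "k \<in> {1..K i}" for i k
    using noise_strict_antimono[OF that, of pu putot] pu0[OF that] fe[OF that]
    by (cases "pu i k = putot i k") (auto simp: noise_def gamma_def)
  have low: "\<Gamma> / M i * (noise pu i k + R i) \<le> pdl i k" if "i \<in> {1..G}" "k \<in> {1..K i}" for i k
  proof -
    have "0 < noise pu i k + R i" using noise_pos[of i k pu] R0[of i] pu0 that by simp
    moreover have "\<Gamma> \<le> M i * pdl i k / (noise pu i k + R i)"
      using ge[OF that] SINR_eq[OF that, of pu pdl] pu0[OF that] tot by (simp add: R_def)
    ultimately have "\<Gamma> * (noise pu i k + R i) \<le> M i * pdl i k" by (simp add: pos_le_divide_eq)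
    then show ?thesis using M_pos[of i] that by (simp add: field_simps)
  qed
  have low': "\<Gamma> / M i * (noise putot i k + R i) \<le> \<Gamma> / M i * (noise pu i k + R i)"
    if "i \<in> {1..G}" "k \<in> {1..K i}" for i k
    using noise_le[OF that] M_pos[of i] \<Gamma>_pos that by (intro mult_left_mono) auto
  have sum_low: "(\<Sum>k=1..K i. \<Gamma> / M i * (noise putot i k + R i)) = \<Gamma> / M i * (\<Delta> i + real (K i) * R i)"
    for i unfolding sum_distrib_left[symmetric] by (simp add: sum.distrib Delta_noise)
  have S_le: "S i \<le> R i" if i: "i \<in> {1..G}" for i
  proof -
    have "\<Gamma> / M i * (\<Delta> i + real (K i) * R i) \<le> R i"
      unfolding sum_low[symmetric] using order_trans[OF low' low] i
      \<comment> \<open>Only the right-hand \<open>R i\<close> is unfolded, so that two sums over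
        the group are compared termwise.\<close>
      by (subst (2) R_def) (auto intro!: sum_mono)
    then have "\<Gamma> * \<Delta> i \<le> R i * (M i - \<Gamma> * real (K i))"
      using M_pos[OF i] by (simp add: field_simps)
    then show ?thesis unfolding S_eq using bspec[OF den i] by (simp add: pos_divide_le_eq)
  qed
  have S_R: "S i = R i" if i: "i \<in> {1..G}" for i
  proof (rule sum_le_imp_eq[of "{1..G}"])
    \<comment> \<open>Both sums are \<open>Ptot\<close>, one by feasibility and the other by
      \<open>balance\<close>.\<close>
    show "sum R {1..G} \<le> sum S {1..G}"
      using tot balance by (simp add: total_power_def R_def S_eq)
  qed (use S_le i in auto)
  have tight: "\<Gamma> / M i * (noise putot i k + R i) = pdl i k"
    if ik: "i \<in> {1..G}" "k \<in> {1..K i}" for i k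
  proof (rule sum_le_imp_eq[of "{1..K i}"])
    have "(\<Sum>k=1..K i. \<Gamma> / M i * (noise putot i k + R i)) = R i"
      unfolding sum_low using group_power_fixpoint[OF ik(1) bspec[OF den ik(1)]] S_R[OF ik(1)] by simp
    then show "sum (pdl i) {1..K i} \<le> (\<Sum>k=1..K i. \<Gamma> / M i * (noise putot i k + R i))"
      by (simp add: R_def)
  next
    show "\<Gamma> / M i * (noise putot i k + R i) \<le> pdl i k" if "k \<in> {1..K i}" for k
      using low[OF ik(1) that] low'[OF ik(1) that] by linarith
  qed (use ik in auto)
  have "pu i k = putot i k" if ik: "i \<in> {1..G}" "k \<in> {1..K i}" for i k
  proof (rule ccontr)
    assume "pu i k \<noteq> putot i k"
    then have "noise putot i k < noise pu i k"
      using noise_strict_antimono[OF ik, of pu putot] pu0[OF ik] fe[OF ik] by simp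
    then have "\<Gamma> / M i * (noise putot i k + R i) < \<Gamma> / M i * (noise pu i k + R i)"
      using \<Gamma>_pos M_pos[OF ik(1)] by (intro mult_strict_left_mono) auto
    then show False using tight[OF ik] low[OF ik] by linarith
  qed
  then show ?thesis
    unfolding candidate_def optimal_pdl_eq using tight S_R by auto
qed

text \<open>Candidates attain \<Gamma>, and a feasible point reaching at least \<Gamma> is itself a
  candidate, so the optimal value is exactly \<Gamma>.\<close>

lemma max_min_optimal_iff_candidate:
  "max_min_optimal G K N \<tau> \<beta> putot Ptot pu pdl \<longleftrightarrow> candidate \<Gamma> pu pdl"
proof -
  have min_eq: "min_SINR G K N \<tau> \<beta> qu qdl = \<Gamma>" if "candidate \<Gamma> qu qdl" for qu qdl
    using candidate_SINR(2)[OF that] by (rule min_SINR_const)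
  have min_ge: "candidate \<Gamma> qu qdl"
    if "feasible G K putot Ptot qu qdl" "\<Gamma> \<le> min_SINR G K N \<tau> \<beta> qu qdl" for qu qdl
    using that min_SINR_le order_trans by (intro SINR_ge_imp_candidate) blast+
  have "candidate \<Gamma> putot (optimal_pdl G K N \<tau> \<beta> putot Ptot \<Gamma>)"
    by (simp add: candidate_def)
  note attained = candidate_SINR(1)[OF this] min_eq[OF this]
  show ?thesis
  proof
    assume "max_min_optimal G K N \<tau> \<beta> putot Ptot pu pdl"
    then have "feasible G K putot Ptot pu pdl" "\<Gamma> \<le> min_SINR G K N \<tau> \<beta> pu pdl"
      using attained unfolding max_min_optimal_def is_arg_max_def by (force simp: not_less)+
    then show "candidate \<Gamma> pu pdl" using min_ge by blast
  next
    assume c: "candidate \<Gamma> pu pdl"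
    have "\<not> min_SINR G K N \<tau> \<beta> pu pdl < min_SINR G K N \<tau> \<beta> qu qdl"
      if "feasible G K putot Ptot qu qdl" for qu qdl
      using min_ge[OF that] min_eq[OF c] min_eq[of qu qdl] by fastforce
    then show "max_min_optimal G K N \<tau> \<beta> putot Ptot pu pdl"
      using candidate_SINR(1)[OF c] unfolding max_min_optimal_def is_arg_max_def by auto
  qed
qed

end

end

theorem theorem2:
  fixes G N T \<tau> :: nat and K :: "nat \<Rightarrow> nat"
    and \<beta> putot :: "nat \<Rightarrow> nat \<Rightarrow> real" and Ptot :: real
  assumes "1 \<le> G"
    and "\<And>j. j \<in> {1..G} \<Longrightarrow> 1 \<le> K j"
    and "\<tau> \<in> {K_tot G K..T}"
    and "\<And>i. i \<in> {1..G} \<Longrightarrow> nu G K i < N"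
    and "\<And>j k. j \<in> {1..G} \<Longrightarrow> k \<in> {1..K j} \<Longrightarrow> 0 < \<beta> j k"
    and "\<And>j k. j \<in> {1..G} \<Longrightarrow> k \<in> {1..K j} \<Longrightarrow> 0 < putot j k"
    and "0 < Ptot"
  shows "\<exists>\<Gamma>.
    (\<forall>\<Gamma>'. ((\<forall>i\<in>{1..G}. 0 < real N - real (nu G K i) - \<Gamma>' * real (K i)) \<and>
            Ptot = (\<Sum>i=1..G. \<Gamma>' * Delta K \<tau> \<beta> putot Ptot i /
                              (real N - real (nu G K i) - \<Gamma>' * real (K i))))
          \<longleftrightarrow> \<Gamma>' = \<Gamma>) \<and>
    (\<exists>pu pdl. max_min_optimal G K N \<tau> \<beta> putot Ptot pu pdl) \<and>
    (\<forall>pu pdl. max_min_optimal G K N \<tau> \<beta> putot Ptot pu pdl \<longleftrightarrow>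
       (\<forall>i\<in>{1..G}. \<forall>k\<in>{1..K i}.
          pu i k = putot i k \<and> pdl i k = optimal_pdl G K N \<tau> \<beta> putot Ptot \<Gamma> i k)) \<and>
    (\<forall>pu pdl. max_min_optimal G K N \<tau> \<beta> putot Ptot pu pdl \<longrightarrow>
       (\<forall>i\<in>{1..G}. \<forall>k\<in>{1..K i}. SINR G K N \<tau> \<beta> pu pdl i k = \<Gamma>))"
proof -
  \<comment> \<open>This lower bound on the pilot length gives the locale its
    \<open>0 < \<tau>\<close>.\<close>
  have "0 < K_tot G K"
    unfolding K_tot_def using assms(1,2) by (intro sum_pos) (auto simp: Suc_le_eq)
  then interpret multicast G N \<tau> K \<beta> putot Ptot
    using assms by unfold_locales auto
  obtain \<Gamma> where "0 < \<Gamma>" and \<Gamma>: "\<And>\<Gamma>'. ((\<forall>i\<in>{1..G}. 0 < M i - \<Gamma>' * real (K i)) \<and>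
      Ptot = (\<Sum>i=1..G. \<Gamma>' * \<Delta> i / (M i - \<Gamma>' * real (K i)))) \<longleftrightarrow> \<Gamma>' = \<Gamma>"
    using ex1_sum_ratio_eq[of "{1..G}" M "\<lambda>i. real (K i)" \<Delta> Ptot]
      assms(1) K M_pos Delta_pos Ptot by fastforce
  have den: "\<forall>i\<in>{1..G}. 0 < M i - \<Gamma> * real (K i)"
    using \<Gamma>[of \<Gamma>] by blast
  have balance: "Ptot = (\<Sum>i=1..G. \<Gamma> * \<Delta> i / (M i - \<Gamma> * real (K i)))"
    using \<Gamma>[of \<Gamma>] by blast
  note opt = max_min_optimal_iff_candidate[OF \<open>0 < \<Gamma>\<close> den balance]
  have "max_min_optimal G K N \<tau> \<beta> putot Ptot putot (optimal_pdl G K N \<tau> \<beta> putot Ptot \<Gamma>)"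
    by (simp add: opt candidate_def)
  moreover have "sinr pu pdl i k = \<Gamma>"
    if "candidate \<Gamma> pu pdl" "i \<in> {1..G}" "k \<in> {1..K i}" for pu pdl i k
    using candidate_SINR(2)[OF \<open>0 < \<Gamma>\<close> den balance] that by blast
  ultimately show ?thesis
    using \<Gamma> unfolding M_def opt candidate_def by (intro exI[of _ \<Gamma>] conjI allI impI ballI) blast+
qed

end
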